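(* For every positive integer $k$, $$\operatorname{RR}\bigl(x+y+z+kv=(k+5)w\bigr)=\begin{cases} 3 & \text{for } k=1,2,3,4,\\ 5 & \text{for } 5\leq k\leq 11 \text{ and } k=13,14,17,\\ 6 & \text{for } k=12,15,16,18,19,22,\\ 8 & \text{for } k=21,23,24 \text{ and } 26\leq k\leq 29,\\ 9 & \text{for } k=20,25 \text{ and } k\geq 30. \end{cases}$$
   Context: For a linear equation $\mathcal{E}$ in positive-integer variables, the 2-color Rado number $\operatorname{RR}(\mathcal{E})$ is the least positive integer $N$, if it exists, such that every 2-coloring of $[1,N]=\{1,\ldots,N\}$ admits a solution of $\mathcal{E}$ in $[1,N]$ all of whose variables take values (not necessarily distinct) of the same color. *)

theory Defs
  imports Main
begin

text \<open>A linear equation \<open>c\<^sub>1 x\<^sub>1 + \<dots> + c\<^sub>m x\<^sub>m = b\<close> with integer data is represented by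
  \<open>([c\<^sub>1, \<dots>, c\<^sub>m], b)\<close>; a tuple of values of its variables is a list.\<close>

type_synonym lin_eq = "int list \<times> int"

definition solves :: "nat list \<Rightarrow> lin_eq \<Rightarrow> bool" where
  "solves xs E \<longleftrightarrow> length xs = length (fst E) \<and>
     (\<Sum>i<length xs. fst E ! i * int (xs ! i)) = snd E"

text \<open>A 2-coloring of \<open>{1..N}\<close> is given by a function on \<^typ>\<open>nat\<close>,
  whose values outside \<open>{1..N}\<close> play no role.\<close>

definition every_2coloring_has_mono_solution :: "lin_eq \<Rightarrow> nat \<Rightarrow> bool" where
  "every_2coloring_has_mono_solution E N \<longleftrightarrow>
     (\<forall>\<chi> :: nat \<Rightarrow> bool. \<exists>xs. solves xs E \<and> set xs \<subseteq> {1..N} \<and>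
        (\<exists>c. \<forall>x\<in>set xs. \<chi> x = c))"

text \<open>The value \<^const>\<open>None\<close> means that the Rado number does not exist.\<close>

definition RR :: "lin_eq \<Rightarrow> nat option" where
  "RR E =
     (if \<exists>N\<ge>1. every_2coloring_has_mono_solution E N
      then Some (LEAST N. N \<ge> 1 \<and> every_2coloring_has_mono_solution E N)
      else None)"

text \<open>The equation \<open>x + y + z + k v = (k + 5) w\<close>, in the variables \<open>[x, y, z, v, w]\<close>.\<close>

definition rado_eq :: "nat \<Rightarrow> lin_eq" where
  "rado_eq k = ([1, 1, 1, int k, - (int k + 5)], 0)"

lemma solves_rado_eq_iff:
  "solves xs (rado_eq k) \<longleftrightarrow>
     (\<exists>x y z v w. xs = [x, y, z, v, w] \<and> x + y + z + k * v = (k + 5) * w)"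
proof -
  have eq: "solves [x, y, z, v, w] (rado_eq k) \<longleftrightarrow> x + y + z + k * v = (k + 5) * w"
    for x y z v w
  proof -
    have "solves [x, y, z, v, w] (rado_eq k) \<longleftrightarrow>
        int (x + y + z + k * v) = int ((k + 5) * w)"
      by (simp add: solves_def rado_eq_def lessThan_Suc numeral_eq_Suc algebra_simps)
    then show ?thesis
      by (simp only: of_nat_eq_iff)
  qed
  have "\<exists>x y z v w. xs = [x, y, z, v, w]" if "solves xs (rado_eq k)"
    using that by (auto simp: solves_def rado_eq_def length_Suc_conv)
  with eq show ?thesis
    by blast
qed

end

theory Submission imports Defs begin

text \<open>The solutions with \<open>v = w\<close>, that is \<open>x + y + z = 5 w\<close>, do not depend on \<open>k\<close>.
  They force the two elements of each of the pairs \<open>{1,2}\<close>, \<open>{1,3}\<close>, \<open>{2,4}\<close>, \<open>{3,5}\<close>, \<open>{2,6}\<close>,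
  \<open>{4,8}\<close>, \<open>{3,9}\<close> to have different colors, and prevent \<open>4, 6, 7\<close> from having the same color.
  So, up to swapping the colors, the only coloring of \<open>{1..N}\<close> with \<open>N \<le> 8\<close> that can avoid
  monochromatic solutions has the color class \<open>{1, 4, 5, 6} \<inter> {1..N}\<close>. For \<open>N = 9\<close> the number
  \<open>9\<close> would have to join this class, which is impossible as \<open>5 + 6 + 9 = 5 \<cdot> 4\<close>. It remains to
  see for which \<open>k\<close> the two classes of this one coloring contain a solution.\<close>

definition has_sol :: "nat \<Rightarrow> nat set \<Rightarrow> bool" where
  "has_sol k S \<longleftrightarrow>
     (\<exists>x\<in>S. \<exists>y\<in>S. \<exists>z\<in>S. \<exists>v\<in>S. \<exists>w\<in>S. x + y + z + k * v = (k + 5) * w)"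

lemma has_solI:
  "x + y + z + k * v = (k + 5) * w \<Longrightarrow> {x, y, z, v, w} \<subseteq> S \<Longrightarrow> has_sol k S"
  unfolding has_sol_def by blast

lemma has_sol_const:
  "x + y + z = 5 * w \<Longrightarrow> {x, y, z, w} \<subseteq> S \<Longrightarrow> has_sol k S"
  by (rule has_solI[of x y z k w w]) (auto simp: algebra_simps)

lemma has_sol_mono: "has_sol k S \<Longrightarrow> S \<subseteq> T \<Longrightarrow> has_sol k T"
  unfolding has_sol_def by blast

lemma every_rado_iff:
  "every_2coloring_has_mono_solution (rado_eq k) N \<longleftrightarrow>
     (\<forall>A. has_sol k ({1..N} \<inter> A) \<or> has_sol k ({1..N} - A))"
proof -
  have "(\<exists>xs. solves xs (rado_eq k) \<and> set xs \<subseteq> {1..N} \<and> (\<exists>c. \<forall>x\<in>set xs. \<chi> x = c)) \<longleftrightarrow>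
      has_sol k ({1..N} \<inter> Collect \<chi>) \<or> has_sol k ({1..N} - Collect \<chi>)" (is "?L \<longleftrightarrow> ?R")
    for \<chi> :: "nat \<Rightarrow> bool"
  proof
    assume ?L
    then obtain x y z v w c where *: "x + y + z + k * v = (k + 5) * w"
      "{x, y, z, v, w} \<subseteq> {1..N}" "\<forall>u\<in>{x, y, z, v, w}. \<chi> u = c"
      by (auto simp: solves_rado_eq_iff)
    then have "{x, y, z, v, w} \<subseteq> {1..N} \<inter> Collect \<chi> \<or> {x, y, z, v, w} \<subseteq> {1..N} - Collect \<chi>"
      by (cases c) auto
    then show ?R
      using has_solI[OF *(1)] by blast
  next
    assume ?R
    then obtain c where "has_sol k {u \<in> {1..N}. \<chi> u = c}"
    proof
      assume a: "has_sol k ({1..N} \<inter> Collect \<chi>)"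
      show thesis by (rule that[of True], rule has_sol_mono[OF a]) auto
    next
      assume a: "has_sol k ({1..N} - Collect \<chi>)"
      show thesis by (rule that[of False], rule has_sol_mono[OF a]) auto
    qed
    then obtain x y z v w where *: "x + y + z + k * v = (k + 5) * w"
      "{x, y, z, v, w} \<subseteq> {u \<in> {1..N}. \<chi> u = c}"
      unfolding has_sol_def by blast
    then show ?L
      by (intro exI[of _ "[x, y, z, v, w]"]) (auto simp: solves_rado_eq_iff)
  qed
  then have "every_2coloring_has_mono_solution (rado_eq k) N \<longleftrightarrow>
      (\<forall>\<chi>. has_sol k ({1..N} \<inter> Collect \<chi>) \<or> has_sol k ({1..N} - Collect \<chi>))"
    unfolding every_2coloring_has_mono_solution_def by (simp only:)
  also have "\<dots> \<longleftrightarrow> (\<forall>A. has_sol k ({1..N} \<inter> A) \<or> has_sol k ({1..N} - A))" (is "?L \<longleftrightarrow> ?R")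
  proof (intro iffI allI)
    fix A assume ?L
    then show "has_sol k ({1..N} \<inter> A) \<or> has_sol k ({1..N} - A)"
      by (elim allE[of _ "\<lambda>x. x \<in> A"]) (simp only: Collect_mem_eq)
  qed (elim allE)
  finally show ?thesis .
qed

lemma every_rado_mono:
  "every_2coloring_has_mono_solution (rado_eq k) M \<Longrightarrow> M \<le> N \<Longrightarrow>
     every_2coloring_has_mono_solution (rado_eq k) N"
  unfolding every_rado_iff
  using has_sol_mono[of k "{1..M} \<inter> A" "{1..N} \<inter> A" for A]
    has_sol_mono[of k "{1..M} - A" "{1..N} - A" for A]
  by fastforce

text \<open>Solutions survive when the interval grows, so failure at the single predecessor
  \<open>M\<close> excludes every smaller bound.\<close>

lemma RR_eqI:
  assumes "every_2coloring_has_mono_solution (rado_eq k) N"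
    and "\<not> every_2coloring_has_mono_solution (rado_eq k) M" and "N = Suc M"
  shows "RR (rado_eq k) = Some N"
proof -
  have "(LEAST M. M \<ge> 1 \<and> every_2coloring_has_mono_solution (rado_eq k) M) = N"
  proof (rule Least_equality)
    fix L assume "L \<ge> 1 \<and> every_2coloring_has_mono_solution (rado_eq k) L"
    then show "N \<le> L"
      using assms(2,3) every_rado_mono not_less_eq_eq by blast
  qed (use assms(1,3) in simp)
  with assms(1,3) show ?thesis
    unfolding RR_def by (metis le_add1 plus_1_eq_Suc)
qed

lemma coloring_forced:
  assumes "1 \<in> A" and P: "\<not> has_sol k ({1..N} \<inter> A)" and Q: "\<not> has_sol k ({1..N} - A)"
  shows "N \<le> 8" and "{1..N} \<inter> A = {1..N} \<inter> {1, 4, 5, 6}"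
proof -
  \<comment> \<open>The guards such as \<open>2 \<le> N\<close> let one chain of deductions serve
    every interval \<open>{1..N}\<close>.\<close>
  have 2: "2 \<notin> A" if "2 \<le> N"
    using that \<open>1 \<in> A\<close> P has_sol_const[of 1 2 2 1 "{1..N} \<inter> A" k] by (auto simp del: One_nat_def)
  have 3: "3 \<notin> A" if "3 \<le> N"
    using that \<open>1 \<in> A\<close> P has_sol_const[of 1 1 3 1 "{1..N} \<inter> A" k] by (auto simp del: One_nat_def)
  have 4: "4 \<in> A" if "4 \<le> N"
    using that 2 Q has_sol_const[of 2 4 4 2 "{1..N} - A" k] by (auto simp del: One_nat_def)
  have 5: "5 \<in> A" if "5 \<le> N"
    using that 3 Q has_sol_const[of 5 5 5 3 "{1..N} - A" k] by (auto simp del: One_nat_def)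
  have 6: "6 \<in> A" if "6 \<le> N"
    using that 2 Q has_sol_const[of 2 2 6 2 "{1..N} - A" k] by (auto simp del: One_nat_def)
  have 7: "7 \<notin> A" if "7 \<le> N"
    using that 4 6 P has_sol_const[of 6 7 7 4 "{1..N} \<inter> A" k] by (auto simp del: One_nat_def)
  have 8: "8 \<notin> A" if "8 \<le> N"
    using that 4 P has_sol_const[of 4 8 8 4 "{1..N} \<inter> A" k] by (auto simp del: One_nat_def)
  show "N \<le> 8"
  proof (rule ccontr)
    assume N: "\<not> N \<le> 8"
    then have "9 \<notin> A"
      using 4 5 6 P has_sol_const[of 5 6 9 4 "{1..N} \<inter> A" k] by (auto simp del: One_nat_def)
    with N show False
      using 3 Q has_sol_const[of 3 3 9 3 "{1..N} - A" k] by (auto simp del: One_nat_def)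
  qed
  then have "u \<in> A \<longleftrightarrow> u \<in> {1, 4, 5, 6}" if "u \<in> {1..N}" for u
  proof -
    from that have "u \<in> {1, 2, 3, 4, 5, 6, 7, 8}" "u \<le> N"
      using \<open>N \<le> 8\<close> by auto
    then show ?thesis
      using \<open>1 \<in> A\<close> 2 3 4 5 6 7 8 by (elim insertE emptyE; simp del: One_nat_def)
  qed
  then show "{1..N} \<inter> A = {1..N} \<inter> {1, 4, 5, 6}"
    by blast
qed

lemma every_rado_iff_forced:
  "every_2coloring_has_mono_solution (rado_eq k) N \<longleftrightarrow>
     N \<ge> 9 \<or> has_sol k ({1..N} \<inter> {1, 4, 5, 6}) \<or> has_sol k ({1..N} - {1, 4, 5, 6})"
  (is "?L \<longleftrightarrow> ?R")
proof
  assume ?L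
  then show ?R unfolding every_rado_iff by blast
next
  \<comment> \<open>A coloring without monochromatic solutions is the forced one with
    \<open>N \<le> 8\<close>, so all three alternatives in \<open>?R\<close> fail.\<close>
  have *: "\<not> ?R" if "1 \<in> A" "\<not> has_sol k ({1..N} \<inter> A)" "\<not> has_sol k ({1..N} - A)" for A
  proof -
    note forced = coloring_forced[OF that]
    moreover from forced(2) have "{1..N} - A = {1..N} - {1, 4, 5, 6}" by blast
    ultimately show ?thesis using that(2,3) by auto
  qed
  assume ?R
  have "has_sol k ({1..N} \<inter> A) \<or> has_sol k ({1..N} - A)" for A
  proof (cases "1 \<in> A")
    case True
    with * \<open>?R\<close> show ?thesis by blast
  next
    case False
    \<comment> \<open>Swapping the two colors puts 1 into the class \<open>- A\<close>.\<close>
    with *[of "- A"] \<open>?R\<close> show ?thesis by (auto simp: Diff_eq)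
  qed
  then show ?L unfolding every_rado_iff by blast
qed

lemma initial_classes:
  "{1..2} \<inter> {1, 4, 5, 6} = {1::nat}"       "{1..2} - {1, 4, 5, 6} = {2::nat}"
  "{1..3} \<inter> {1, 4, 5, 6} = {1::nat}"       "{1..3} - {1, 4, 5, 6} = {2, 3::nat}"
  "{1..4} \<inter> {1, 4, 5, 6} = {1, 4::nat}"    "{1..4} - {1, 4, 5, 6} = {2, 3::nat}"
  "{1..5} \<inter> {1, 4, 5, 6} = {1, 4, 5::nat}" "{1..5} - {1, 4, 5, 6} = {2, 3::nat}"
  "{1..6} \<inter> {1, 4, 5, 6} = {1, 4, 5, 6::nat}" "{1..6} - {1, 4, 5, 6} = {2, 3::nat}"
  "{1..7} \<inter> {1, 4, 5, 6} = {1, 4, 5, 6::nat}" "{1..7} - {1, 4, 5, 6} = {2, 3, 7::nat}"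
  "{1..8} \<inter> {1, 4, 5, 6} = {1, 4, 5, 6::nat}" "{1..8} - {1, 4, 5, 6} = {2, 3, 7, 8::nat}"
  by auto

text \<open>For fixed \<open>v\<close> and \<open>w\<close> only the sum \<open>x + y + z\<close>
  matters, and the set of these sums is independent of \<open>k\<close>.\<close>

definition sums3 :: "nat set \<Rightarrow> nat set" where
  "sums3 S = (\<Union>x\<in>S. \<Union>y\<in>S. (\<lambda>z. x + y + z) ` S)"

lemma has_sol_iff_sums3:
  "has_sol k S \<longleftrightarrow> (\<exists>v\<in>S. \<exists>w\<in>S. \<exists>t\<in>sums3 S. t + k * v = (k + 5) * w)"
  unfolding has_sol_def sums3_def by blast

lemma sums3_classes:
  "sums3 {1} = {3}"
  "sums3 {2} = {6}"
  "sums3 {2, 3} = {6, 7, 8, 9}"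
  "sums3 {1, 4} = {3, 6, 9, 12}"
  "sums3 {1, 4, 5} = {3, 6, 7, 9, 10, 11, 12, 13, 14, 15}"
  "sums3 {1, 4, 5, 6} = {3, 6, 7, 8, 9, 10, 11, 12, 13, 14, 15, 16, 17, 18}"
  "sums3 {2, 3, 7} = {6, 7, 8, 9, 11, 12, 13, 16, 17, 21}"
  "sums3 {2, 3, 7, 8} = {6, 7, 8, 9, 11, 12, 13, 14, 16, 17, 18, 19, 21, 22, 23, 24}"
  unfolding sums3_def by (rule equalityI; simp)+

lemmas every_rado_eval =
  every_rado_iff_forced initial_classes has_sol_iff_sums3 sums3_classes bex_simps(3,5)

text \<open>Taking \<open>v = 3\<close>, \<open>w = 2\<close> requires the sum
  \<open>10 - k\<close>, which runs through 6, 7, 8, 9, all the sums from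
  \<open>{2, 3}\<close>.\<close>

lemma RR_3: "k \<in> {1, 2, 3, 4} \<Longrightarrow> RR (rado_eq k) = Some 3"
  by (rule RR_eqI[where M = 2]; (unfold every_rado_eval)?; elim insertE emptyE; simp)

text \<open>Here \<open>v = 5\<close>, \<open>w = 4\<close> requires the sum \<open>20 - k\<close>;
  these \<open>k\<close> are exactly those for which it lies in
  \<open>sums3 {1, 4, 5}\<close>.\<close>

lemma RR_5: "k \<in> {5, 6, 7, 8, 9, 10, 11, 13, 14, 17} \<Longrightarrow> RR (rado_eq k) = Some 5"
  by (rule RR_eqI[where M = 4]; (unfold every_rado_eval)?; elim insertE emptyE; simp)

text \<open>Here \<open>v = 6\<close>, \<open>w = 5\<close> works, with the sum
  \<open>25 - k\<close> in \<open>sums3 {1, 4, 5, 6}\<close>.\<close>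

lemma RR_6: "k \<in> {12, 15, 16, 18, 19, 22} \<Longrightarrow> RR (rado_eq k) = Some 6"
  by (rule RR_eqI[where M = 5]; (unfold every_rado_eval)?; elim insertE emptyE; simp)

text \<open>Here \<open>v = 8\<close>, \<open>w = 7\<close> works, with the sum
  \<open>35 - k\<close> in \<open>sums3 {2, 3, 7, 8}\<close>.\<close>

lemma RR_8: "k \<in> {21, 23, 24, 26, 27, 28, 29} \<Longrightarrow> RR (rado_eq k) = Some 8"
  by (rule RR_eqI[where M = 7]; (unfold every_rado_eval)?; elim insertE emptyE; simp)

lemma RR_9:
  assumes "k \<in> {20, 25} \<union> {30..}"
  shows "RR (rado_eq k) = Some 9"
proof (rule RR_eqI[where M = 8])
  show "every_2coloring_has_mono_solution (rado_eq k) 9"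
    by (simp add: every_rado_iff_forced)
  \<comment> \<open>The required sum is \<open>5 * w + k * (w - v)\<close> over the integers. It is
    too large if \<open>v < w\<close> and not attained if \<open>v = w\<close>. If
    \<open>v > w\<close>, it is too small for \<open>k \<ge> 30\<close>; for 20 and 25 the pair
    \<open>v = 8\<close>, \<open>w = 7\<close> requires 15 and 10, both missing from
    \<open>sums3 {2, 3, 7, 8}\<close>.\<close>
  show "\<not> every_2coloring_has_mono_solution (rado_eq k) 8"
    using assms unfolding every_rado_eval
    by (elim UnE insertE emptyE; simp add: add_mult_distrib)
qed simp

theorem theorem4p2:
  fixes k :: nat
  assumes "k \<ge> 1"
  shows "(k \<in> {1, 2, 3, 4} \<longrightarrow> RR (rado_eq k) = Some 3) \<and>
         (k \<in> {5..11} \<union> {13, 14, 17} \<longrightarrow> RR (rado_eq k) = Some 5) \<and>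
         (k \<in> {12, 15, 16, 18, 19, 22} \<longrightarrow> RR (rado_eq k) = Some 6) \<and>
         (k \<in> {21, 23, 24} \<union> {26..29} \<longrightarrow> RR (rado_eq k) = Some 8) \<and>
         (k \<in> {20, 25} \<union> {30..} \<longrightarrow> RR (rado_eq k) = Some 9)"
proof (intro conjI impI)
  assume "k \<in> {5..11} \<union> {13, 14, 17}"
  then have "k \<in> {5, 6, 7, 8, 9, 10, 11, 13, 14, 17}" by auto
  then show "RR (rado_eq k) = Some 5" by (rule RR_5)
next
  assume "k \<in> {21, 23, 24} \<union> {26..29}"
  then have "k \<in> {21, 23, 24, 26, 27, 28, 29}" by auto
  then show "RR (rado_eq k) = Some 8" by (rule RR_8)
qed (fact RR_3 RR_6 RR_9)+

end
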